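(* Let $\operatorname{Orb}_{c_1;c_2}$ be a generic adjoint orbit of $\mathfrak{so}(4)$, $c_1>|c_2|$, and let $a=\frac{1}{\sqrt2}(\sqrt{c_1+c_2}+\sqrt{c_1-c_2})$, $b=\frac{1}{\sqrt2}(\sqrt{c_1+c_2}-\sqrt{c_1-c_2})$. If $|c_2|>0$, then the equilibria of the $\mathfrak{so}(4)$ rigid body equations on $\operatorname{Orb}_{c_1;c_2}$ are the twelve points $M^i_{a,b},M^i_{-a,-b},M^i_{b,a},M^i_{-b,-a}$, $i=1,2,3$ (forming three Weyl group orbits in $\mathfrak{t}_1,\mathfrak{t}_2,\mathfrak{t}_3$), together with the elements of $\mathfrak{s}_\pm$ whose parameters $(b_1,b_2,b_3)\in\mathbb{R}^3$ satisfy $$c_1=\frac{b_1^2}{2}\left(\frac{\lambda_2+\lambda_3}{\lambda_1+\lambda_4}+\frac{\lambda_1+\lambda_4}{\lambda_2+\lambda_3}\right)+\frac{b_2^2}{2}\left(\frac{\lambda_1+\lambda_3}{\lambda_2+\lambda_4}+\frac{\lambda_2+\lambda_4}{\lambda_1+\lambda_3}\right)+\frac{b_3^2}{2}\left(\frac{\lambda_1+\lambda_2}{\lambda_3+\lambda_4}+\frac{\lambda_3+\lambda_4}{\lambda_1+\lambda_2}\right),$$ $$c_2=\pm(b_1^2+b_2^2+b_3^2),$$ with the sign $\pm$ corresponding to $\mathfrak{s}_\pm$. If $c_2=0$, then the only equilibria on $\operatorname{Orb}_{c_1;c_2}$ are the twelve isolated points $M^i_{a,b},M^i_{-a,-b},M^i_{b,a},M^i_{-b,-a}$,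 $i=1,2,3$, forming three Weyl group orbits in $\mathfrak{t}_1,\mathfrak{t}_2,\mathfrak{t}_3$.
   Context: Let $\lambda_1,\lambda_2,\lambda_3,\lambda_4$ be distinct real numbers with $\lambda_i+\lambda_j>0$ for $i\ne j$, and $J=\operatorname{diag}(\lambda_1,\lambda_2,\lambda_3,\lambda_4)$. The $\mathfrak{so}(4)$ rigid body equation is $\dot M=[M,\Omega]$ on $\mathfrak{so}(4)$ (real antisymmetric $4\times4$ matrices), where $\Omega\in\mathfrak{so}(4)$ is determined by $M=J\Omega+\Omega J$. Write $$M=\begin{bmatrix}0&-x_3&x_2&y_1\\ x_3&0&-x_1&y_2\\ -x_2&x_1&0&y_3\\ -y_1&-y_2&-y_3&0\end{bmatrix}.$$ For $c_1>|c_2|$, $\operatorname{Orb}_{c_1;c_2}=\{M\mid \frac12(\sum x_i^2+\sum y_i^2)=c_1,\ \sum x_iy_i=c_2\}$, a regular (generic) adjoint orbit of $\operatorname{SO}(4)$. For $i\in\{1,2,3\}$, $M^i_{p,q}$ is the matrix with $x_i=p$, $y_i=q$ and all other coordinates $0$; $\mathfrak{t}_i=\{M^i_{p,q}\mid p,q\in\mathbb{R}\}$. The subspaces $\mathfrak{s}_\pm$ are the sets of matrices of the form $$x_1=\frac{a_1}{\lambda_1+\lambda_4},\ x_2=\frac{a_2}{\lambda_2+\lambda_4},\ x_3=\frac{a_3}{\lambda_3+\lambda_4},\quad y_1=\pm\frac{a_1}{\lambda_2+\lambda_3},\ y_2=\pm\frac{a_2}{\lambda_1+\lambda_3},\ y_3=\pm\frac{a_3}{\lambda_1+\lambda_2},$$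 with $a_1,a_2,a_3\in\mathbb{R}$ and the same sign in all three $y_i$; their elements are parametrized by $$b_1=\frac{a_1}{\sqrt{(\lambda_1+\lambda_4)(\lambda_2+\lambda_3)}},\quad b_2=\frac{a_2}{\sqrt{(\lambda_2+\lambda_4)(\lambda_1+\lambda_3)}},\quad b_3=\frac{a_3}{\sqrt{(\lambda_3+\lambda_4)(\lambda_1+\lambda_2)}}.$$ *)

theory Defs
  imports "HOL-Analysis.Analysis"
begin

definition so4 :: "(real^4^4) set" where
  "so4 = {M. transpose M = - M}"

definition so4_mat :: "real^3 \<Rightarrow> real^3 \<Rightarrow> real^4^4" where
  "so4_mat x y = vector
     [vector [0,     - x$3,  x$2,   y$1],
      vector [x$3,   0,      - x$1, y$2],
      vector [- x$2, x$1,    0,     y$3],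
      vector [- y$1, - y$2,  - y$3, 0]]"

definition commutator :: "real^4^4 \<Rightarrow> real^4^4 \<Rightarrow> real^4^4" where
  "commutator A B = A ** B - B ** A"

definition diag4 :: "(4 \<Rightarrow> real) \<Rightarrow> real^4^4" where
  "diag4 l = (\<chi> i j. if i = j then l i else 0)"

(* The angular velocity is well defined on so4 as soon as l i + l j \<noteq> 0 for i \<noteq> j;
   see angular_velocity_ex1 below. *)
definition angular_velocity :: "(4 \<Rightarrow> real) \<Rightarrow> real^4^4 \<Rightarrow> real^4^4" where
  "angular_velocity l M = (THE W. W \<in> so4 \<and> M = diag4 l ** W + W ** diag4 l)"

definition rigid_body_field :: "(4 \<Rightarrow> real) \<Rightarrow> real^4^4 \<Rightarrow> real^4^4" where
  "rigid_body_field l M = commutator M (angular_velocity l M)"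

definition rigid_body_equilibria :: "(4 \<Rightarrow> real) \<Rightarrow> (real^4^4) set \<Rightarrow> (real^4^4) set" where
  "rigid_body_equilibria l S = {M \<in> S. rigid_body_field l M = 0}"

definition Orb :: "real \<Rightarrow> real \<Rightarrow> (real^4^4) set" where
  "Orb c1 c2 = {so4_mat x y | x y.
     1/2 * ((\<Sum>i\<in>UNIV. (x$i)\<^sup>2) + (\<Sum>i\<in>UNIV. (y$i)\<^sup>2)) = c1 \<and>
     (\<Sum>i\<in>UNIV. x$i * y$i) = c2}"

definition M_pt :: "3 \<Rightarrow> real \<Rightarrow> real \<Rightarrow> real^4^4" where
  "M_pt i p q = so4_mat (axis i p) (axis i q)"

definition t_space :: "3 \<Rightarrow> (real^4^4) set" where
  "t_space i = {M_pt i p q | p q. True}"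

definition Ad :: "real^4^4 \<Rightarrow> real^4^4 \<Rightarrow> real^4^4" where
  "Ad Q X = Q ** X ** transpose Q"

(* For a Cartan subalgebra t with maximal torus T = exp t, the stabiliser of t in SO(4) is the
   normaliser N(T), and the elements acting trivially on t form Z(T) = T.  The Weyl group
   N(T)/T is represented by its faithful action on t. *)
definition weyl_group :: "(real^4^4) set \<Rightarrow> (real^4^4 \<Rightarrow> real^4^4) set" where
  "weyl_group t = {restrict (Ad Q) t | Q. rotation_matrix Q \<and> Ad Q ` t = t}"

definition weyl_orbit :: "(real^4^4) set \<Rightarrow> real^4^4 \<Rightarrow> (real^4^4) set" where
  "weyl_orbit t X = {w X | w. w \<in> weyl_group t}"

(* The elements of s_+ (for e = 1) and of s_- (for e = -1). *)
definition s_mat :: "(4 \<Rightarrow> real) \<Rightarrow> real \<Rightarrow> real^3 \<Rightarrow> real^4^4" where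
  "s_mat l e a = so4_mat
     (vector [a$1 / (l 1 + l 4), a$2 / (l 2 + l 4), a$3 / (l 3 + l 4)])
     (vector [e * (a$1 / (l 2 + l 3)), e * (a$2 / (l 1 + l 3)), e * (a$3 / (l 1 + l 2))])"

definition s_param :: "(4 \<Rightarrow> real) \<Rightarrow> real^3 \<Rightarrow> real^3" where
  "s_param l a = vector
     [a$1 / sqrt ((l 1 + l 4) * (l 2 + l 3)),
      a$2 / sqrt ((l 2 + l 4) * (l 1 + l 3)),
      a$3 / sqrt ((l 3 + l 4) * (l 1 + l 2))]"

lemma vector_4_nth [simp]:
  "(vector [x,y,z,w] :: ('a::zero)^4) $ 1 = x"
  "(vector [x,y,z,w] :: ('a::zero)^4) $ 2 = y"
  "(vector [x,y,z,w] :: ('a::zero)^4) $ 3 = z"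
  "(vector [x,y,z,w] :: ('a::zero)^4) $ 4 = w"
  by (simp_all add: vector_def)

lemma so4_skew:
  assumes "M \<in> so4"
  shows "M $ j $ i = - M $ i $ j"
proof -
  have "transpose M $ i $ j = (- M) $ i $ j"
    using assms unfolding so4_def by simp
  then show ?thesis by (simp add: transpose_def)
qed

lemma so4_eq_range: "so4 = {so4_mat x y | x y. True}"
proof (intro set_eqI iffI)
  fix M assume "M \<in> so4"
  note skew = so4_skew[OF this]
  have diag: "M $ i $ i = 0" for i
    using skew[of i i] by simp
  have "M = so4_mat (vector [M$3$2, M$1$3, M$2$1]) (vector [M$1$4, M$2$4, M$3$4])"
    unfolding so4_mat_def vec_eq_iff forall_4
    using diag skew[of 1 2] skew[of 3 1] skew[of 2 3] skew[of 1 4] skew[of 2 4] skew[of 3 4]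
    by simp
  then show "M \<in> {so4_mat x y | x y. True}" by blast
next
  fix M assume "M \<in> {so4_mat x y | x y. True}"
  then obtain x y where M: "M = so4_mat x y" by blast
  show "M \<in> so4"
    unfolding M so4_def so4_mat_def mem_Collect_eq vec_eq_iff forall_4
    by (simp add: transpose_def)
qed

lemma diag4_anticommutator_nth:
  "(diag4 l ** W + W ** diag4 l) $ i $ j = (l i + l j) * W $ i $ j"
proof -
  have "(diag4 l ** W) $ i $ j = (\<Sum>k\<in>UNIV. if i = k then l i * W $ k $ j else 0)"
    unfolding diag4_def matrix_matrix_mult_def vec_lambda_beta by (intro sum.cong) auto
  moreover have "(W ** diag4 l) $ i $ j = (\<Sum>k\<in>UNIV. if j = k then W $ i $ k * l k else 0)"
    unfolding diag4_def matrix_matrix_mult_def vec_lambda_beta by (intro sum.cong) auto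
  ultimately show ?thesis by (simp add: distrib_right)
qed

lemma angular_velocity_ex1:
  assumes "\<And>i j. i \<noteq> j \<Longrightarrow> l i + l j > 0" and "M \<in> so4"
  shows "\<exists>!W. W \<in> so4 \<and> M = diag4 l ** W + W ** diag4 l"
proof -
  have diag: "X $ i $ i = 0" if "X \<in> so4" for X :: "real^4^4" and i
    using so4_skew[OF that, of i i] by simp
  have nz: "l i + l j \<noteq> 0" if "i \<noteq> j" for i j
    using assms(1)[OF that] by simp
  define W :: "real^4^4" where "W = (\<chi> i j. M$i$j / (l i + l j))"
  have "W \<in> so4"
    unfolding so4_def mem_Collect_eq vec_eq_iff
  proof (intro allI)
    fix i j show "transpose W $ i $ j = (- W) $ i $ j"
      using so4_skew[OF assms(2), of j i] by (simp add: W_def transpose_def add.commute)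
  qed
  moreover have "M = diag4 l ** W + W ** diag4 l"
    unfolding vec_eq_iff
  proof (intro allI)
    fix i j show "M$i$j = (diag4 l ** W + W ** diag4 l) $ i $ j"
      unfolding diag4_anticommutator_nth
      using nz[of i j] diag[OF assms(2), of i] by (cases "i = j") (simp_all add: W_def)
  qed
  moreover have "V = W" if "V \<in> so4" "M = diag4 l ** V + V ** diag4 l" for V
  proof -
    have "M$i$j = (l i + l j) * V$i$j" for i j
      using that(2) diag4_anticommutator_nth[of l V i j] by metis
    then have "V$i$j = W$i$j" for i j
      using nz[of i j] diag[OF that(1), of i] diag[OF assms(2), of i]
      by (cases "i = j") (simp_all add: W_def)
    then show ?thesis by (simp add: vec_eq_iff)
  qed
  ultimately show ?thesis by blast
qed

end

theory Submission
  imports Defs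
begin

text \<open>
  Let \<open>W\<close> be the angular velocity of \<open>M\<close> and \<open>J = diag4 l\<close>. Substituting \<open>M = J W + W J\<close> into
  \<open>[M, W]\<close> the mixed terms \<open>W J W\<close> cancel and \<open>[J, W\<^sup>2]\<close> remains. As \<open>J\<close> is diagonal with distinct
  entries, \<open>M\<close> is an equilibrium iff \<open>W\<^sup>2\<close> is diagonal. For \<open>W = so4_mat u v\<close> the off-diagonal
  entries of \<open>W\<^sup>2\<close> are, up to sign, \<open>u\<^sub>i u\<^sub>j - v\<^sub>i v\<^sub>j\<close> and \<open>u\<^sub>i v\<^sub>j - u\<^sub>j v\<^sub>i\<close>, and all of them vanish iff
  \<open>(u + v)\<^sub>i (u - v)\<^sub>j = 0\<close> whenever \<open>i \<noteq> j\<close>: the two vectors \<open>u \<plusminus> v\<close> are the components of \<open>W\<close> in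
  \<open>so(4) = so(3) \<oplus> so(3)\<close>. So either one of them is zero, which puts \<open>M\<close> in one of the spaces
  \<open>s\<^sub>\<plusminus>\<close>, or both are supported on the same coordinate \<open>i\<close>, which puts \<open>M\<close> in \<open>t_space i\<close>. This is
  \<open>rigid_body_field_eq_0_iff\<close>.

  It remains to intersect these spaces with the orbit. On \<open>t_space i\<close> the orbit prescribes
  \<open>p\<^sup>2 + q\<^sup>2 = 2 c1\<close> and \<open>p q = c2\<close>, that is, \<open>(p + q)\<^sup>2\<close> and \<open>(p - q)\<^sup>2\<close>, both nonzero on a generic
  orbit; this leaves the four points of \<open>P i\<close>. On \<open>s\<^sub>\<plusminus>\<close> the orbit equations are the two
  quadratic equations in the parameters \<open>b\<close>, and for \<open>c2 = 0\<close> the second one forces \<open>b = 0\<close>, against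
  \<open>c1 > 0\<close>.

  The Weyl group orbits (\<open>weyl_orbit_M_pt\<close>) come from the same pair of quantities: \<open>p\<^sup>2 + q\<^sup>2\<close> is a
  multiple of \<open>trace (M\<^sup>2)\<close> and \<open>p q\<close> is minus the Pfaffian, so rotations preserve both, and
  conversely the four solutions are permuted transitively by the double transpositions of
  the coordinates of \<open>\<real>\<^sup>4\<close>, which are rotations.
\<close>

section \<open>Coordinates and the orbit\<close>

lemma so4_mat_in_so4: "so4_mat x y \<in> so4"
  unfolding so4_eq_range by blast

lemma so4_mat_eq_iff: "so4_mat x y = so4_mat x' y' \<longleftrightarrow> x = x' \<and> y = y'"
  unfolding so4_mat_def vec_eq_iff[where 'a = "real^4"] vec_eq_iff[where 'a = real] forall_4 forall_3
  by auto

lemma so4_mat_in_Orb_iff: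
  "so4_mat x y \<in> Orb c1 c2 \<longleftrightarrow>
     (x$1)\<^sup>2 + (x$2)\<^sup>2 + (x$3)\<^sup>2 + ((y$1)\<^sup>2 + (y$2)\<^sup>2 + (y$3)\<^sup>2) = 2 * c1 \<and>
     x$1 * y$1 + x$2 * y$2 + x$3 * y$3 = c2"
  unfolding Orb_def mem_Collect_eq so4_mat_eq_iff sum_3 by auto

lemma M_pt_in_Orb_iff:
  "M_pt i p q \<in> Orb c1 c2 \<longleftrightarrow> p\<^sup>2 + q\<^sup>2 = 2 * c1 \<and> p * q = c2"
  unfolding M_pt_def so4_mat_in_Orb_iff using exhaust_3[of i] by (auto simp: axis_def)

lemma M_pt_eq_iff:
  "M_pt i p q = M_pt j p' q' \<longleftrightarrow> p = p' \<and> q = q' \<and> (i = j \<or> p = 0 \<and> q = 0)"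
  unfolding M_pt_def so4_mat_eq_iff axis_eq_axis by auto

text \<open>Both sides prescribe \<open>(p' + q')\<^sup>2\<close> and \<open>(p' - q')\<^sup>2\<close>; the four points are the four choices of
  signs for the square roots. The same list serves the orbit equations and the Weyl group.\<close>

lemma sum_squares_and_product_eq_iff:
  fixes p q p' q' :: real
  shows "p'\<^sup>2 + q'\<^sup>2 = p\<^sup>2 + q\<^sup>2 \<and> p' * q' = p * q \<longleftrightarrow>
    (p', q') \<in> {(p, q), (- p, - q), (q, p), (- q, - p)}"
    (is "?L \<longleftrightarrow> ?R")
proof
  assume ?L
  then have "(p' + q')\<^sup>2 = (p + q)\<^sup>2" "(p' - q')\<^sup>2 = (p - q)\<^sup>2"
    by (auto simp: power2_sum power2_diff)
  then have "p' + q' = p + q \<or> p' + q' = - (p + q)" "p' - q' = p - q \<or> p' - q' = - (p - q)"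
    by (simp_all only: power2_eq_iff)
  then show ?R by auto
qed auto

section \<open>The equilibrium condition\<close>

lemma angular_velocity_so4_mat:
  assumes "\<And>i j. i \<noteq> j \<Longrightarrow> l i + l j > 0"
  shows "angular_velocity l (so4_mat x y) =
    so4_mat (vector [x$1 / (l 2 + l 3), x$2 / (l 1 + l 3), x$3 / (l 1 + l 2)])
            (vector [y$1 / (l 1 + l 4), y$2 / (l 2 + l 4), y$3 / (l 3 + l 4)])"
    (is "_ = ?W")
  unfolding angular_velocity_def
proof (rule the1_equality[OF angular_velocity_ex1[OF assms so4_mat_in_so4]])
  have "so4_mat x y = diag4 l ** ?W + ?W ** diag4 l"
    unfolding vec_eq_iff[where 'a = "real^4"] vec_eq_iff[where 'a = real]
      diag4_anticommutator_nth forall_4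
    using assms[of 1 2] assms[of 1 3] assms[of 1 4] assms[of 2 3] assms[of 2 4] assms[of 3 4]
    by (simp add: so4_mat_def add.commute)
  then show "?W \<in> so4 \<and> so4_mat x y = diag4 l ** ?W + ?W ** diag4 l"
    using so4_mat_in_so4 by blast
qed

lemma diag4_commutator_nth:
  "commutator (diag4 l) A $ i $ j = (l i - l j) * A $ i $ j"
proof -
  have "(diag4 l ** A) $ i $ j = (\<Sum>k\<in>UNIV. if i = k then l i * A $ k $ j else 0)"
    unfolding diag4_def matrix_matrix_mult_def vec_lambda_beta by (intro sum.cong) auto
  moreover have "(A ** diag4 l) $ i $ j = (\<Sum>k\<in>UNIV. if j = k then A $ i $ k * l k else 0)"
    unfolding diag4_def matrix_matrix_mult_def vec_lambda_beta by (intro sum.cong) auto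
  ultimately show ?thesis by (simp add: commutator_def algebra_simps)
qed

lemma add_matrix_mult_distrib: "(A + B) ** C = A ** C + B ** (C :: real^'n^'m)"
  by (simp add: matrix_matrix_mult_def vec_eq_iff distrib_right sum.distrib)

lemma rigid_body_field_eq_commutator:
  assumes "\<And>i j. i \<noteq> j \<Longrightarrow> l i + l j > 0" and "M \<in> so4"
  defines "W \<equiv> angular_velocity l M"
  shows "rigid_body_field l M = commutator (diag4 l) (W ** W)"
proof -
  have "\<exists>!W. W \<in> so4 \<and> M = diag4 l ** W + W ** diag4 l"
    using angular_velocity_ex1[of l M] assms(1,2) by blast
  from theI'[OF this] have "M = diag4 l ** W + W ** diag4 l"
    unfolding W_def angular_velocity_def by blast
  then have "rigid_body_field l M
      = (diag4 l ** W + W ** diag4 l) ** W - W ** (diag4 l ** W + W ** diag4 l)"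
    unfolding rigid_body_field_def commutator_def W_def[symmetric] by simp
  also have "\<dots> = commutator (diag4 l) (W ** W)"
    by (simp add: commutator_def matrix_mul_assoc matrix_add_ldistrib add_matrix_mult_distrib)
  finally show ?thesis .
qed

text \<open>Adding and subtracting \<open>u\<^sub>i u\<^sub>j = v\<^sub>i v\<^sub>j\<close> and \<open>u\<^sub>i v\<^sub>j = u\<^sub>j v\<^sub>i\<close> gives the factorized form; it is what
  makes the case distinction below immediate.\<close>

lemma so4_mat_square_diagonal_iff:
  "(\<forall>i j. i \<noteq> j \<longrightarrow> (so4_mat u v ** so4_mat u v) $ i $ j = 0) \<longleftrightarrow>
   (\<forall>i j. i \<noteq> j \<longrightarrow> (u + v) $ i * (u - v) $ j = 0)"
  (is "?L \<longleftrightarrow> ?R")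
proof -
  have "?L \<longleftrightarrow>
      u$1 * u$2 = v$1 * v$2 \<and> u$1 * u$3 = v$1 * v$3 \<and> u$2 * u$3 = v$2 * v$3 \<and>
      u$1 * v$2 = u$2 * v$1 \<and> u$1 * v$3 = u$3 * v$1 \<and> u$2 * v$3 = u$3 * v$2"
    unfolding forall_4
    by (auto simp: so4_mat_def matrix_matrix_mult_def sum_4 algebra_simps)
  also have "\<dots> \<longleftrightarrow> ?R"
    unfolding forall_3 by (simp add: algebra_simps) (safe; linarith)
  finally show ?thesis .
qed

lemma both_axis_iff:
  fixes u v :: "real^'n"
  shows "(\<exists>p q. u = axis i p \<and> v = axis i q) \<longleftrightarrow> (\<forall>k. k \<noteq> i \<longrightarrow> u $ k = 0 \<and> v $ k = 0)"
proof
  assume "\<forall>k. k \<noteq> i \<longrightarrow> u $ k = 0 \<and> v $ k = 0"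
  then have "u = axis i (u $ i)" "v = axis i (v $ i)"
    by (auto simp: vec_eq_iff axis_def)
  then show "\<exists>p q. u = axis i p \<and> v = axis i q" by blast
qed (auto simp: axis_def)

text \<open>If neither \<open>u + v\<close> nor \<open>u - v\<close> is zero, then a nonzero coordinate of one must have the same
  index as every nonzero coordinate of the other, so there is only one such index.\<close>

lemma products_off_diagonal_eq_0_iff:
  fixes u v :: "real^'n"
  shows "(\<forall>i j. i \<noteq> j \<longrightarrow> (u + v) $ i * (u - v) $ j = 0) \<longleftrightarrow>
    (\<exists>i p q. u = axis i p \<and> v = axis i q) \<or> v = u \<or> v = - u"
    (is "?L \<longleftrightarrow> ?R")
proof
  assume L: ?L
  show ?R
  proof (cases "v = u \<or> v = - u")
    case False
    then obtain i j where ij: "(u + v) $ i \<noteq> 0" "(u - v) $ j \<noteq> 0"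
      by (auto simp: vec_eq_iff) (metis add.inverse_unique)
    with L have "i = j" by auto
    have "u $ k = 0 \<and> v $ k = 0" if "k \<noteq> i" for k
    proof -
      have "(u + v) $ k = 0" "(u - v) $ k = 0"
        using L that ij \<open>i = j\<close> by (metis mult_eq_0_iff)+
      then show ?thesis by simp
    qed
    then show ?thesis using both_axis_iff[of u i v] by blast
  qed auto
next
  assume ?R
  then show ?L by (auto simp: axis_def)
qed

text \<open>Division by \<open>l i + l j\<close> turns \<open>s\<^sub>\<plusminus>\<close> into the diagonal \<open>v = u\<close> and the antidiagonal \<open>v = - u\<close> of the
  coordinates of the angular velocity.\<close>

lemma eq_s_mat_iff:
  assumes "\<And>i j. i \<noteq> j \<Longrightarrow> l i + l j > 0"
  shows "(\<exists>a. so4_mat x y = s_mat l e a) \<longleftrightarrow>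
    (vector [y$1 / (l 1 + l 4), y$2 / (l 2 + l 4), y$3 / (l 3 + l 4)] :: real^3) =
    e *\<^sub>R vector [x$1 / (l 2 + l 3), x$2 / (l 1 + l 3), x$3 / (l 1 + l 2)]"
    (is "_ \<longleftrightarrow> ?R")
proof -
  have pos: "l 1 + l 2 > 0" "l 1 + l 3 > 0" "l 1 + l 4 > 0" "l 2 + l 3 > 0" "l 2 + l 4 > 0"
    "l 3 + l 4 > 0"
    using assms by auto
  show ?thesis
  proof
    assume "\<exists>a. so4_mat x y = s_mat l e a"
    then show ?R
      using pos unfolding s_mat_def so4_mat_eq_iff
      unfolding vec_eq_iff forall_3 by (auto simp: mult.commute)
  next
    assume ?R
    then have "so4_mat x y = s_mat l e (vector [(l 1 + l 4) * x$1, (l 2 + l 4) * x$2, (l 3 + l 4) * x$3])"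
      using pos unfolding s_mat_def so4_mat_eq_iff
      unfolding vec_eq_iff forall_3 by (auto simp: field_simps)
    then show "\<exists>a. so4_mat x y = s_mat l e a" ..
  qed
qed

proposition rigid_body_field_eq_0_iff:
  assumes "inj l" and pos: "\<And>i j. i \<noteq> j \<Longrightarrow> l i + l j > 0" and "M \<in> so4"
  shows "rigid_body_field l M = 0 \<longleftrightarrow>
    (\<exists>i. M \<in> t_space i) \<or> (\<exists>e\<in>{1, -1}. \<exists>a. M = s_mat l e a)"
proof -
  obtain x y where M: "M = so4_mat x y"
    using \<open>M \<in> so4\<close> unfolding so4_eq_range by blast
  define u v :: "real^3"
    where "u = vector [x$1 / (l 2 + l 3), x$2 / (l 1 + l 3), x$3 / (l 1 + l 2)]"
      and "v = vector [y$1 / (l 1 + l 4), y$2 / (l 2 + l 4), y$3 / (l 3 + l 4)]"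
  have W: "angular_velocity l M = so4_mat u v"
    unfolding M u_def v_def by (rule angular_velocity_so4_mat[OF pos])
  have "rigid_body_field l M = commutator (diag4 l) (so4_mat u v ** so4_mat u v)"
    using rigid_body_field_eq_commutator[of l M] pos \<open>M \<in> so4\<close> W by simp
  then have "rigid_body_field l M = 0 \<longleftrightarrow>
      (\<forall>i j. i \<noteq> j \<longrightarrow> (so4_mat u v ** so4_mat u v) $ i $ j = 0)"
    using inj_eq[OF \<open>inj l\<close>] by (auto simp: vec_eq_iff diag4_commutator_nth)
  also have "\<dots> \<longleftrightarrow> (\<exists>i p q. u = axis i p \<and> v = axis i q) \<or> v = u \<or> v = - u"
    unfolding so4_mat_square_diagonal_iff products_off_diagonal_eq_0_iff ..
  also have "(\<exists>i p q. u = axis i p \<and> v = axis i q) \<longleftrightarrow> (\<exists>i. \<forall>k. k \<noteq> i \<longrightarrow> u$k = 0 \<and> v$k = 0)"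
    by (simp only: both_axis_iff)
  also have "\<dots> \<longleftrightarrow> (\<exists>i. \<forall>k. k \<noteq> i \<longrightarrow> x$k = 0 \<and> y$k = 0)"
    using pos[of 1 2] pos[of 1 3] pos[of 1 4] pos[of 2 3] pos[of 2 4] pos[of 3 4]
    unfolding u_def v_def forall_3 by simp
  also have "\<dots> \<longleftrightarrow> (\<exists>i. M \<in> t_space i)"
    by (simp only: t_space_def mem_Collect_eq simp_thms M M_pt_def so4_mat_eq_iff both_axis_iff)
  finally have "rigid_body_field l M = 0 \<longleftrightarrow>
    (\<exists>i. M \<in> t_space i) \<or> v = 1 *\<^sub>R u \<or> v = (- 1) *\<^sub>R u" by simp
  moreover have "(\<exists>a. M = s_mat l e a) \<longleftrightarrow> v = e *\<^sub>R u" for e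
    unfolding M u_def v_def by (rule eq_s_mat_iff) (rule pos)
  ultimately show ?thesis by blast
qed

text \<open>With \<open>x = a / s\<close>, \<open>y = e a / t\<close> and \<open>b = a / \<surd>(s t)\<close> in each of the three coordinate pairs, \<open>b\<^sup>2\<close> is
  \<open>e x y\<close>, and multiplying it by \<open>t / s\<close> or \<open>s / t\<close> gives \<open>x\<^sup>2\<close> or \<open>y\<^sup>2\<close>.\<close>

lemma s_mat_in_Orb_iff:
  fixes a :: "real^3"
  assumes "\<And>i j. i \<noteq> j \<Longrightarrow> l i + l j > 0" and "e \<in> {1, -1}"
  defines "b \<equiv> s_param l a"
  shows "s_mat l e a \<in> Orb c1 c2 \<longleftrightarrow>
    c1 = (b$1)\<^sup>2 / 2 * ((l 2 + l 3) / (l 1 + l 4) + (l 1 + l 4) / (l 2 + l 3))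
       + (b$2)\<^sup>2 / 2 * ((l 1 + l 3) / (l 2 + l 4) + (l 2 + l 4) / (l 1 + l 3))
       + (b$3)\<^sup>2 / 2 * ((l 1 + l 2) / (l 3 + l 4) + (l 3 + l 4) / (l 1 + l 2)) \<and>
    c2 = e * ((b$1)\<^sup>2 + (b$2)\<^sup>2 + (b$3)\<^sup>2)"
proof -
  have pos: "l 1 + l 2 > 0" "l 1 + l 3 > 0" "l 1 + l 4 > 0" "l 2 + l 3 > 0" "l 2 + l 4 > 0"
    "l 3 + l 4 > 0"
    using assms by auto
  have quadratic: "(r / sqrt (s * t))\<^sup>2 / 2 * (t / s + s / t) = ((r / s)\<^sup>2 + (r / t)\<^sup>2) / 2"
    "(r / sqrt (s * t))\<^sup>2 = r / s * (r / t)" if "s > 0" "t > 0" for r s t :: real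
    using that by (simp_all add: power_divide real_sqrt_mult power_mult_distrib)
      (simp add: power2_eq_square field_simps)+
  have b: "b$1 = a$1 / sqrt ((l 1 + l 4) * (l 2 + l 3))"
    "b$2 = a$2 / sqrt ((l 2 + l 4) * (l 1 + l 3))"
    "b$3 = a$3 / sqrt ((l 3 + l 4) * (l 1 + l 2))"
    by (simp_all add: b_def s_param_def)
  have e: "(e * t)\<^sup>2 = t\<^sup>2" for t using assms(2) by auto
  have regroup: "x1\<^sup>2 + x2\<^sup>2 + x3\<^sup>2 + ((e * y1)\<^sup>2 + (e * y2)\<^sup>2 + (e * y3)\<^sup>2) = 2 * c1 \<and>
      x1 * (e * y1) + x2 * (e * y2) + x3 * (e * y3) = c2 \<longleftrightarrow>
      c1 = (x1\<^sup>2 + y1\<^sup>2) / 2 + (x2\<^sup>2 + y2\<^sup>2) / 2 + (x3\<^sup>2 + y3\<^sup>2) / 2 \<and>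
      c2 = e * (x1 * y1 + x2 * y2 + x3 * y3)" for x1 x2 x3 y1 y2 y3
    unfolding e by (auto simp: field_simps)
  show ?thesis
    unfolding s_mat_def so4_mat_in_Orb_iff b
      quadratic(1)[OF pos(3,4)] quadratic(1)[OF pos(5,2)] quadratic(1)[OF pos(6,1)]
    unfolding quadratic(2)[OF pos(3,4)] quadratic(2)[OF pos(5,2)] quadratic(2)[OF pos(6,1)]
    by (simp only: vector_3 regroup)
qed

section \<open>The Weyl group of a coordinate Cartan subalgebra\<close>

lemma det_4:
  "det (A::real^4^4) =
     A$1$1 * (A$2$2*(A$3$3*A$4$4 - A$3$4*A$4$3) - A$2$3*(A$3$2*A$4$4 - A$3$4*A$4$2) + A$2$4*(A$3$2*A$4$3 - A$3$3*A$4$2))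
   - A$1$2 * (A$2$1*(A$3$3*A$4$4 - A$3$4*A$4$3) - A$2$3*(A$3$1*A$4$4 - A$3$4*A$4$1) + A$2$4*(A$3$1*A$4$3 - A$3$3*A$4$1))
   + A$1$3 * (A$2$1*(A$3$2*A$4$4 - A$3$4*A$4$2) - A$2$2*(A$3$1*A$4$4 - A$3$4*A$4$1) + A$2$4*(A$3$1*A$4$2 - A$3$2*A$4$1))
   - A$1$4 * (A$2$1*(A$3$2*A$4$3 - A$3$3*A$4$2) - A$2$2*(A$3$1*A$4$3 - A$3$3*A$4$1) + A$2$3*(A$3$1*A$4$2 - A$3$2*A$4$1))"
proof -
  have f234: "finite {2::4, 3, 4}" "1 \<notin> {2::4, 3, 4}" by auto
  have f34: "finite {3::4, 4}" "2 \<notin> {3::4, 4}" by auto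
  have f4: "finite {4::4}" "3 \<notin> {4::4}" by auto
  show ?thesis
    unfolding det_def UNIV_4
    unfolding sum_over_permutations_insert[OF f234]
    unfolding sum_over_permutations_insert[OF f34]
    unfolding sum_over_permutations_insert[OF f4]
    unfolding permutes_sing
    by (simp add: sign_swap_id permutation_swap_id permutation_compose sign_compose
        swap_id_eq algebra_simps)
qed

definition pfaffian4 :: "real^4^4 \<Rightarrow> real" where
  "pfaffian4 A = A$1$2 * A$3$4 - A$1$3 * A$2$4 + A$1$4 * A$2$3"

lemma pfaffian4_so4_mat: "pfaffian4 (so4_mat x y) = - (x$1 * y$1 + x$2 * y$2 + x$3 * y$3)"
  by (simp add: pfaffian4_def so4_mat_def)

text \<open>A skew matrix is a skew form, so the entries of its conjugate are combinations of the
  \<open>2 \<times> 2\<close> minors of two rows of \<open>Q\<close>. In this form the identity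
  \<open>Pf (Q X Q\<^sup>T) = det Q Pf X\<close> becomes the Laplace expansion of \<open>det Q\<close> along two rows together with
  the Pluecker relations, small enough for polynomial normalization.\<close>

lemma Ad_so4_mat_nth:
  fixes Q :: "real^4^4" and i j :: 4
  defines "m \<equiv> \<lambda>k k'. Q $ i $ k * Q $ j $ k' - Q $ i $ k' * Q $ j $ k"
  shows "Ad Q (so4_mat x y) $ i $ j =
    x$1 * m 3 2 + x$2 * m 1 3 + x$3 * m 2 1 + y$1 * m 1 4 + y$2 * m 2 4 + y$3 * m 3 4"
  by (simp add: m_def Ad_def matrix_matrix_mult_def transpose_def so4_mat_def sum_4 algebra_simps)

lemma pfaffian4_Ad:
  "pfaffian4 (Ad Q (so4_mat x y)) = det Q * pfaffian4 (so4_mat x y)"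
  unfolding pfaffian4_so4_mat det_4 unfolding pfaffian4_def Ad_so4_mat_nth
  by algebra

text \<open>The trace of the square alone would not separate \<open>(p, q)\<close> from \<open>(p, - q)\<close>; these two are
  exchanged by a reflection. The Pfaffian, which changes sign under reflections, separates them.\<close>

lemma trace_square_Ad:
  assumes "orthogonal_matrix Q"
  shows "trace (Ad Q X ** Ad Q X) = trace (X ** X)"
proof -
  have Q: "transpose Q ** Q = mat 1" using assms by (simp add: orthogonal_matrix_def)
  have "Ad Q X ** Ad Q X = Q ** X ** (transpose Q ** Q) ** X ** transpose Q"
    by (simp add: Ad_def matrix_mul_assoc)
  also have "\<dots> = Q ** (X ** X ** transpose Q)"
    by (simp add: Q matrix_mul_assoc)
  also have "trace \<dots> = trace (X ** X ** (transpose Q ** Q))"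
    by (subst trace_mul_sym) (simp add: matrix_mul_assoc)
  finally show ?thesis by (simp add: Q)
qed

lemma invariants_M_pt:
  "trace (M_pt i p q ** M_pt i p q) = - 2 * (p\<^sup>2 + q\<^sup>2)"
  "pfaffian4 (M_pt i p q) = - (p * q)"
  using exhaust_3[of i]
  by (auto simp: trace_def pfaffian4_def matrix_matrix_mult_def sum_4 M_pt_def so4_mat_def
      axis_def power2_eq_square)

definition perm_mat :: "('n \<Rightarrow> 'n) \<Rightarrow> real^'n^'n" where
  "perm_mat f = (\<chi> i j. if j = f i then 1 else 0)"

lemma Ad_perm_mat: "Ad (perm_mat f) X $ i $ j = X $ f i $ f j"
  by (simp add: Ad_def perm_mat_def matrix_matrix_mult_def transpose_def if_distrib if_distribR
      cong: if_cong)

lemma rotation_matrix_perm_mat: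
  assumes "p \<noteq> q" "r \<noteq> s"
  defines "f \<equiv> Transposition.transpose p q \<circ> Transposition.transpose r s"
  shows "rotation_matrix (perm_mat f :: real^4^4)"
proof -
  have f: "f permutes UNIV" unfolding f_def
    by (intro permutes_compose permutes_swap_id) auto
  have "perm_mat f ** transpose (perm_mat f) = (mat 1 :: real^4^4)"
  proof -
    have "Ad (perm_mat f) (mat 1) = (mat 1 :: real^4^4)"
      using permutes_inj[OF f] by (simp add: vec_eq_iff Ad_perm_mat mat_def inj_eq)
    then show ?thesis by (simp add: Ad_def)
  qed
  then have "orthogonal_matrix (perm_mat f :: real^4^4)"
    by (simp add: orthogonal_matrix_def matrix_left_right_inverse)
  moreover have "(perm_mat f :: real^4^4) = (\<chi> i. mat 1 $ f i)"
    by (auto simp: perm_mat_def mat_def vec_eq_iff)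
  then have "det (perm_mat f :: real^4^4) = of_int (sign f)"
    by (simp only: det_permute_rows[OF f]) simp
  moreover have "sign f = 1"
    unfolding f_def using assms by (simp add: sign_compose permutation_swap_id sign_swap_id)
  ultimately show ?thesis by (simp add: rotation_matrix_def)
qed

text \<open>In \<open>M_pt i p q\<close> the number \<open>q\<close> sits at the position \<open>{i, 4}\<close> and \<open>p\<close> at the complementary pair.
  The double transposition that exchanges the elements within both pairs reverses both signs, and
  the other two exchange the pairs, one preserving the orientations and one reversing both.\<close>

lemma rotations_M_pt:
  assumes "(g :: real \<times> real \<Rightarrow> real \<times> real) \<in>
    {\<lambda>(p, q). (p, q), \<lambda>(p, q). (- p, - q), \<lambda>(p, q). (q, p), \<lambda>(p, q). (- q, - p)}"
  obtains Q where "rotation_matrix Q"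
    "\<And>p q. Ad Q (M_pt i p q) = M_pt i (fst (g (p, q))) (snd (g (p, q)))"
proof -
  define f where "f p q r s = Transposition.transpose p q \<circ> Transposition.transpose r s"
    for p q r s :: 4
  have Q: "rotation_matrix (perm_mat (f p q r s))" if "p \<noteq> q" "r \<noteq> s" for p q r s
    unfolding f_def by (rule rotation_matrix_perm_mat[OF that])
  note calc = vec_eq_iff[where 'a = "real^4"] vec_eq_iff[where 'a = real] Ad_perm_mat forall_4
    M_pt_def so4_mat_def f_def axis_def Transposition.transpose_def
  have r: "rotation_matrix (perm_mat (f 1 2 1 2))" "rotation_matrix (perm_mat (f 1 2 3 4))"
    "rotation_matrix (perm_mat (f 1 3 2 4))" "rotation_matrix (perm_mat (f 1 4 2 3))"
    by (intro Q; simp)+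
  \<comment> \<open>\<open>f 1 2 1 2\<close> is the identity, written as a product of two transpositions like the others.\<close>
  have act: "Ad (perm_mat (f 1 2 1 2)) (M_pt i p q) = M_pt i p q"
    "Ad (perm_mat (f 1 4 2 3)) (M_pt 1 p q) = M_pt 1 (- p) (- q)"
    "Ad (perm_mat (f 1 3 2 4)) (M_pt 1 p q) = M_pt 1 q p"
    "Ad (perm_mat (f 1 2 3 4)) (M_pt 1 p q) = M_pt 1 (- q) (- p)"
    "Ad (perm_mat (f 1 3 2 4)) (M_pt 2 p q) = M_pt 2 (- p) (- q)"
    "Ad (perm_mat (f 1 2 3 4)) (M_pt 2 p q) = M_pt 2 q p"
    "Ad (perm_mat (f 1 4 2 3)) (M_pt 2 p q) = M_pt 2 (- q) (- p)"
    "Ad (perm_mat (f 1 2 3 4)) (M_pt 3 p q) = M_pt 3 (- p) (- q)"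
    "Ad (perm_mat (f 1 4 2 3)) (M_pt 3 p q) = M_pt 3 q p"
    "Ad (perm_mat (f 1 3 2 4)) (M_pt 3 p q) = M_pt 3 (- q) (- p)" for i p q
    by (simp_all add: calc)
  have "\<exists>Q. rotation_matrix Q \<and> (\<forall>p q. Ad Q (M_pt i p q) = M_pt i (fst (g (p, q))) (snd (g (p, q))))"
    using exhaust_3[of i] assms
    by (elim disjE insertE emptyE) (force intro: r simp: act)+
  then show ?thesis using that by blast
qed

text \<open>The invariants bound the orbit from above, and the double transpositions attain the bound.
  Each of them acts on \<open>t_space i\<close> as an involution, hence maps it onto itself.\<close>

proposition weyl_orbit_M_pt:
  "weyl_orbit (t_space i) (M_pt i p q) =
     {M_pt i p q, M_pt i (- p) (- q), M_pt i q p, M_pt i (- q) (- p)}"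
proof (intro equalityI subsetI)
  fix X assume "X \<in> weyl_orbit (t_space i) (M_pt i p q)"
  then obtain Q where Q: "rotation_matrix Q" "Ad Q ` t_space i = t_space i"
    and X: "X = restrict (Ad Q) (t_space i) (M_pt i p q)"
    unfolding weyl_orbit_def weyl_group_def by blast
  have t: "M_pt i p q \<in> t_space i" unfolding t_space_def by blast
  with X have X: "X = Ad Q (M_pt i p q)" by simp
  with t Q(2) have "X \<in> t_space i" by blast
  then obtain p' q' where X': "X = M_pt i p' q'" unfolding t_space_def by blast
  have "trace (X ** X) = trace (M_pt i p q ** M_pt i p q)"
    unfolding X using Q(1) by (intro trace_square_Ad) (simp add: rotation_matrix_def)
  moreover have "pfaffian4 X = pfaffian4 (M_pt i p q)"
    unfolding X M_pt_def pfaffian4_Ad using Q(1) by (simp add: rotation_matrix_def)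
  ultimately have "p'\<^sup>2 + q'\<^sup>2 = p\<^sup>2 + q\<^sup>2 \<and> p' * q' = p * q"
    unfolding X' invariants_M_pt by simp
  then show "X \<in> {M_pt i p q, M_pt i (- p) (- q), M_pt i q p, M_pt i (- q) (- p)}"
    unfolding sum_squares_and_product_eq_iff X' by auto
next
  have *: "M_pt i (fst (g (p, q))) (snd (g (p, q))) \<in> weyl_orbit (t_space i) (M_pt i p q)"
    if g: "g \<in> {\<lambda>(p, q). (p, q), \<lambda>(p, q). (- p, - q), \<lambda>(p, q). (q, p), \<lambda>(p, q). (- q, - p)}"
    for g :: "real \<times> real \<Rightarrow> real \<times> real"
  proof -
    obtain Q where Q: "rotation_matrix Q"
      "\<And>p q. Ad Q (M_pt i p q) = M_pt i (fst (g (p, q))) (snd (g (p, q)))"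
      using rotations_M_pt[OF g] by blast
    have invol: "g (g z) = z" for z using g by (cases z) auto
    have "Ad Q ` t_space i = t_space i"
    proof (intro equalityI subsetI)
      fix X assume "X \<in> t_space i"
      then obtain p q where X: "X = M_pt i p q" unfolding t_space_def by blast
      have "X = Ad Q (M_pt i (fst (g (p, q))) (snd (g (p, q))))"
        unfolding X Q(2) by (simp add: invol)
      then show "X \<in> Ad Q ` t_space i" unfolding t_space_def by blast
    next
      fix X assume "X \<in> Ad Q ` t_space i"
      then obtain p q where "X = Ad Q (M_pt i p q)" unfolding t_space_def by blast
      then show "X \<in> t_space i" unfolding t_space_def Q(2) by blast
    qed
    then have "restrict (Ad Q) (t_space i) \<in> weyl_group (t_space i)"
      using Q(1) unfolding weyl_group_def by blast
    moreover have "restrict (Ad Q) (t_space i) (M_pt i p q)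
        = M_pt i (fst (g (p, q))) (snd (g (p, q)))"
      unfolding Q(2)[symmetric] by (auto simp: t_space_def)
    ultimately show ?thesis
      unfolding weyl_orbit_def mem_Collect_eq by metis
  qed
  fix X assume "X \<in> {M_pt i p q, M_pt i (- p) (- q), M_pt i q p, M_pt i (- q) (- p)}"
  then show "X \<in> weyl_orbit (t_space i) (M_pt i p q)"
    using *[of "\<lambda>(p, q). (p, q)"] *[of "\<lambda>(p, q). (- p, - q)"] *[of "\<lambda>(p, q). (q, p)"]
      *[of "\<lambda>(p, q). (- q, - p)"]
    by auto
qed

section \<open>Equilibria on a generic orbit\<close>


theorem corollary4p2:
  fixes l :: "4 \<Rightarrow> real" and c1 c2 a b :: real and P :: "3 \<Rightarrow> (real^4^4) set"
  assumes l_distinct: "inj l"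
    and l_pos: "\<And>i j. i \<noteq> j \<Longrightarrow> l i + l j > 0"
    and generic: "c1 > \<bar>c2\<bar>"
    and a_def: "a = 1 / sqrt 2 * (sqrt (c1 + c2) + sqrt (c1 - c2))"
    and b_def: "b = 1 / sqrt 2 * (sqrt (c1 + c2) - sqrt (c1 - c2))"
    and P_def: "\<And>i. P i = {M_pt i a b, M_pt i (-a) (-b), M_pt i b a, M_pt i (-b) (-a)}"
  shows
    "card (\<Union>i. P i) = 12 \<and>
     (\<forall>i. P i \<subseteq> t_space i \<and> (\<forall>X\<in>P i. weyl_orbit (t_space i) X = P i)) \<and>
     (\<bar>c2\<bar> > 0 \<longrightarrow>
        rigid_body_equilibria l (Orb c1 c2) =
          (\<Union>i. P i) \<union>
          (\<Union>e\<in>{1, -1}. {s_mat l e a' | a' b'.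
             b' = s_param l a' \<and>
             c1 = (b'$1)\<^sup>2 / 2 * ((l 2 + l 3) / (l 1 + l 4) + (l 1 + l 4) / (l 2 + l 3))
                + (b'$2)\<^sup>2 / 2 * ((l 1 + l 3) / (l 2 + l 4) + (l 2 + l 4) / (l 1 + l 3))
                + (b'$3)\<^sup>2 / 2 * ((l 1 + l 2) / (l 3 + l 4) + (l 3 + l 4) / (l 1 + l 2)) \<and>
             c2 = e * ((b'$1)\<^sup>2 + (b'$2)\<^sup>2 + (b'$3)\<^sup>2)})) \<and>
     (c2 = 0 \<longrightarrow>
        rigid_body_equilibria l (Orb c1 c2) = (\<Union>i. P i) \<and>
        (\<forall>M\<in>(\<Union>i. P i). M isolated_in rigid_body_equilibria l (Orb c1 c2)))"
proof -
  define S where "S e = {s_mat l e a' | a' b'.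
             b' = s_param l a' \<and>
             c1 = (b'$1)\<^sup>2 / 2 * ((l 2 + l 3) / (l 1 + l 4) + (l 1 + l 4) / (l 2 + l 3))
                + (b'$2)\<^sup>2 / 2 * ((l 1 + l 3) / (l 2 + l 4) + (l 2 + l 4) / (l 1 + l 3))
                + (b'$3)\<^sup>2 / 2 * ((l 1 + l 2) / (l 3 + l 4) + (l 3 + l 4) / (l 1 + l 2)) \<and>
             c2 = e * ((b'$1)\<^sup>2 + (b'$2)\<^sup>2 + (b'$3)\<^sup>2)}" for e
  have c: "c1 + c2 > 0" "c1 - c2 > 0" using generic by auto
  have sqrts: "(sqrt (c1 + c2))\<^sup>2 = c1 + c2" "(sqrt (c1 - c2))\<^sup>2 = c1 - c2"
    using c by simp_all
  have ab_plus: "a + b = sqrt 2 * sqrt (c1 + c2)" and ab_minus: "a - b = sqrt 2 * sqrt (c1 - c2)"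
    unfolding a_def b_def by (simp_all add: field_simps)
  have ab_pos: "a + b > 0" "a - b > 0"
    unfolding ab_plus ab_minus using c by simp_all
  have "(a + b)\<^sup>2 = 2 * (c1 + c2)" "(a - b)\<^sup>2 = 2 * (c1 - c2)"
    unfolding ab_plus ab_minus power_mult_distrib sqrts by simp_all
  then have ab: "a\<^sup>2 + b\<^sup>2 = 2 * c1" "a * b = c2"
    by (simp_all add: power2_sum power2_diff)

  have P_iff: "M_pt i p q \<in> Orb c1 c2 \<longleftrightarrow> M_pt i p q \<in> P i" for i p q
  proof -
    have "M_pt i p q \<in> Orb c1 c2 \<longleftrightarrow> (p, q) \<in> {(a, b), (- a, - b), (b, a), (- b, - a)}"
      unfolding M_pt_in_Orb_iff ab[symmetric] sum_squares_and_product_eq_iff ..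
    also have "\<dots> \<longleftrightarrow> M_pt i p q \<in> P i"
      unfolding P_def by (simp add: M_pt_eq_iff)
    finally show ?thesis .
  qed
  have P_t: "P i \<subseteq> t_space i" for i
    unfolding P_def t_space_def by blast
  have P: "P i = Orb c1 c2 \<inter> t_space i" for i
    using P_t[of i] P_iff[of i] unfolding t_space_def by blast

  have "card (P i) = 4" for i
    unfolding P_def using ab_pos by (simp add: M_pt_eq_iff)
  moreover have "P i \<inter> P j = {}" if "i \<noteq> j" for i j
    unfolding P_def using ab_pos that by (auto simp: M_pt_eq_iff)
  moreover have fin: "finite (P i)" for i unfolding P_def by simp
  ultimately have card: "card (\<Union>i. P i) = 12"
    by (subst card_UN_disjoint) auto

  have weyl: "weyl_orbit (t_space i) X = P i" if "X \<in> P i" for i X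
    using that unfolding P_def by (auto simp: weyl_orbit_M_pt)

  have S: "S e = {M \<in> Orb c1 c2. \<exists>a'. M = s_mat l e a'}" if "e \<in> {1, -1}" for e
    unfolding S_def using s_mat_in_Orb_iff[of l e _ c1 c2] l_pos that by blast
  have Orb_so4: "M \<in> so4" if "M \<in> Orb c1 c2" for M
    using that so4_mat_in_so4 unfolding Orb_def by blast
  have eq: "rigid_body_equilibria l (Orb c1 c2) = (\<Union>i. P i) \<union> (\<Union>e\<in>{1, -1}. S e)"
  proof (rule set_eqI)
    fix M
    have "rigid_body_field l M = 0 \<longleftrightarrow>
        (\<exists>i. M \<in> t_space i) \<or> (\<exists>e\<in>{1, -1}. \<exists>a. M = s_mat l e a)" if "M \<in> Orb c1 c2"
      using rigid_body_field_eq_0_iff[of l M] l_distinct l_pos Orb_so4[OF that] by blast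
    then have "M \<in> rigid_body_equilibria l (Orb c1 c2) \<longleftrightarrow>
        (\<exists>i. M \<in> P i) \<or> (\<exists>e\<in>{1, -1}. M \<in> S e)"
      unfolding rigid_body_equilibria_def P mem_Collect_eq Int_iff using S by auto
    then show "M \<in> rigid_body_equilibria l (Orb c1 c2) \<longleftrightarrow>
        M \<in> (\<Union>i. P i) \<union> (\<Union>e\<in>{1, -1}. S e)"
      by simp
  qed

  have eq0: "rigid_body_equilibria l (Orb c1 c2) = (\<Union>i. P i)" if "c2 = 0"
  proof -
    have "S e = {}" if "e \<in> {1, -1}" for e
    proof -
      \<comment> \<open>\<open>t1\<close>, \<open>t2\<close>, \<open>t3\<close> stand for the coefficients in the equation for \<open>c1\<close>.\<close>
      have False if "c2 = e * ((b'$1)\<^sup>2 + (b'$2)\<^sup>2 + (b'$3)\<^sup>2)"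
        "c1 = (b'$1)\<^sup>2 / 2 * t1 + (b'$2)\<^sup>2 / 2 * t2 + (b'$3)\<^sup>2 / 2 * t3"
        for b' :: "real^3" and t1 t2 t3
      proof -
        have "(b'$1)\<^sup>2 + (b'$2)\<^sup>2 + (b'$3)\<^sup>2 = 0"
          using that(1) \<open>c2 = 0\<close> \<open>e \<in> {1, -1}\<close> by auto
        then have "(b'$1)\<^sup>2 = 0 \<and> (b'$2)\<^sup>2 = 0 \<and> (b'$3)\<^sup>2 = 0"
          by (smt (verit) zero_le_power2)
        with that(2) generic show False by simp
      qed
      then show ?thesis unfolding S_def by blast
    qed
    then show ?thesis unfolding eq by simp
  qed
  have isolated: "M isolated_in (\<Union>i. P i)" if "M \<in> (\<Union>i. P i)" for M
    using that fin by (simp add: isolated_in_islimpt_iff islimpt_finite)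
  show ?thesis
    using card P_t weyl eq[unfolded S_def] eq0 isolated
    by (intro conjI allI ballI impI) (simp_all only: eq0)
qed

end
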